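(* Let $n\ge 3$ and let $H_n$ be the crown graph with $U=\{u_1,\dots,u_n\}$, $V=\{v_1,\dots,v_n\}$ and $u_iv_j\in E(H_n)$ iff $i\neq j$. Then $\operatorname{fp}(H_n)=2$ and $\operatorname{width}(\mathcal P_U)=\operatorname{width}(\mathcal P_V)=n$.
   Context: A bipartite graph is a Ferrers graph if it contains no induced copy of $2K_2$ (two disjoint edges with no other edges among their four endpoints). For a bipartite graph $G=(U,V,E)$, $\operatorname{fp}(G)$ is the minimum $k$ such that $E$ can be partitioned into $k$ sets $E_i$ with each spanning subgraph $(U,V,E_i)$ a Ferrers graph. $\operatorname{width}(\mathcal P_U)$ is the maximum number of pairwise inclusion-incomparable sets in the family of neighborhoods $\{N(u):u\in U\}$ (the width of the poset $u\preceq u'$ iff $N(u)\subseteq N(u')$); $\operatorname{width}(\mathcal P_V)$ is defined symmetrically. *)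

theory Defs
  imports "HOL-Library.Disjoint_Sets"
begin

record 'a bigraph =
  part_U :: "'a set"
  part_V :: "'a set"
  edges :: "'a set set"

definition bipartite_graph :: "'a bigraph \<Rightarrow> bool" where
  "bipartite_graph G \<longleftrightarrow>
     finite (part_U G) \<and> finite (part_V G) \<and> part_U G \<inter> part_V G = {} \<and>
     edges G \<subseteq> {{u, v} | u v. u \<in> part_U G \<and> v \<in> part_V G}"

definition has_induced_2K2 :: "'a bigraph \<Rightarrow> bool" where
  "has_induced_2K2 G \<longleftrightarrow>
     (\<exists>e \<in> edges G. \<exists>f \<in> edges G. e \<inter> f = {} \<and>
        (\<forall>g \<in> edges G. g \<subseteq> e \<union> f \<longrightarrow> g = e \<or> g = f))"

definition ferrers :: "'a bigraph \<Rightarrow> bool" where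
  "ferrers G \<longleftrightarrow> bipartite_graph G \<and> \<not> has_induced_2K2 G"

text \<open>The blocks of a \<^const>\<open>partition_on\<close> are nonempty. Allowing empty blocks would not
  change the minimum, except for an edgeless graph, where it is 0 here. Finiteness of the
  partition is required because \<^const>\<open>card\<close> is 0 on infinite sets.\<close>

definition fp :: "'a bigraph \<Rightarrow> nat" where
  "fp G = (LEAST k. \<exists>P. partition_on (edges G) P \<and> finite P \<and> card P = k \<and>
                        (\<forall>F \<in> P. ferrers (G\<lparr>edges := F\<rparr>)))"

definition nbhd :: "'a bigraph \<Rightarrow> 'a \<Rightarrow> 'a set" where
  "nbhd G x = {y. {x, y} \<in> edges G}"

text \<open>\<^const>\<open>pairwise\<close> ranges over ordered pairs of distinct elements, so both
  inclusions are excluded.\<close>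

definition family_width :: "'a set set \<Rightarrow> nat" where
  "family_width \<F> = Max {card \<A> | \<A>. \<A> \<subseteq> \<F> \<and> pairwise (\<lambda>X Y. \<not> X \<subseteq> Y) \<A>}"

definition width_U :: "'a bigraph \<Rightarrow> nat" where
  "width_U G = family_width (nbhd G ` part_U G)"

definition width_V :: "'a bigraph \<Rightarrow> nat" where
  "width_V G = family_width (nbhd G ` part_V G)"

text \<open>The vertices \<open>u\<^sub>i\<close> and \<open>v\<^sub>j\<close> are \<^term>\<open>Inl i\<close> and \<^term>\<open>Inr j\<close>.\<close>

definition crown :: "nat \<Rightarrow> (nat + nat) bigraph" where
  "crown n = \<lparr>part_U = Inl ` {1..n}, part_V = Inr ` {1..n},
     edges = {{Inl i, Inr j} | i j. i \<in> {1..n} \<and> j \<in> {1..n} \<and> i \<noteq> j}\<rparr>"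

lemma bipartite_graph_crown: "bipartite_graph (crown n)"
proof -
  have "edges (crown n) \<subseteq> {{u, v} | u v. u \<in> part_U (crown n) \<and> v \<in> part_V (crown n)}"
  proof
    fix e assume "e \<in> edges (crown n)"
    then obtain i j where "e = {Inl i, Inr j}" "i \<in> {1..n}" "j \<in> {1..n}"
      unfolding crown_def by auto
    moreover from this have "Inl i \<in> part_U (crown n)" "Inr j \<in> part_V (crown n)"
      by (simp_all add: crown_def)
    ultimately show "e \<in> {{u, v} | u v. u \<in> part_U (crown n) \<and> v \<in> part_V (crown n)}"
      by (intro CollectI exI conjI)
  qed
  then show ?thesis
    unfolding bipartite_graph_def by (auto simp: crown_def)
qed

end

theory Submission imports Defs begin

text \<open>The edges \<open>u\<^sub>iv\<^sub>j\<close> with \<open>i < j\<close> and those with \<open>i > j\<close> both form Ferrers graphs, since any two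
  edges \<open>u\<^sub>iv\<^sub>j\<close>, \<open>u\<^sub>kv\<^sub>l\<close> with \<open>i < j\<close>, \<open>k < l\<close> and \<open>i < k\<close> come with the cross edge \<open>u\<^sub>iv\<^sub>l\<close>. The crown
  itself is not Ferrers because of \<open>u\<^sub>1v\<^sub>2\<close> and \<open>u\<^sub>2v\<^sub>1\<close>. The neighborhoods are the complements of
  distinct singletons, hence an antichain.\<close>

text \<open>Edges are unordered, but the tags \<open>Inl\<close> and \<open>Inr\<close> fix which
  endpoint is which. The edge set thus determines \<open>R\<close>, and questions about edges become
  questions about index pairs.\<close>

definition rel_edges :: "('a \<times> 'b) set \<Rightarrow> ('a + 'b) set set" where
  "rel_edges R = {{Inl i, Inr j} | i j. (i, j) \<in> R}"

lemma pair_in_rel_edges_iff [simp]: "{Inl i, Inr j} \<in> rel_edges R \<longleftrightarrow> (i, j) \<in> R"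
  by (auto simp: rel_edges_def doubleton_eq_iff)

lemma rel_edgesE:
  assumes "e \<in> rel_edges R"
  obtains i j where "e = {Inl i, Inr j}" "(i, j) \<in> R"
  using assms by (auto simp: rel_edges_def)

lemma rel_edges_Un: "rel_edges (R \<union> S) = rel_edges R \<union> rel_edges S"
  by (auto simp: rel_edges_def)

lemma rel_edges_disjoint: "R \<inter> S = {} \<Longrightarrow> rel_edges R \<inter> rel_edges S = {}"
  by (auto simp: doubleton_eq_iff elim!: rel_edgesE)

lemma edges_crown: "edges (crown n) = rel_edges {(i, j) \<in> {1..n} \<times> {1..n}. i \<noteq> j}"
  by (simp add: crown_def rel_edges_def conj_assoc)

text \<open>By bipartiteness, two disjoint edges can be joined only by \<open>{Inl i, Inr l}\<close>
  or \<open>{Inl k, Inr j}\<close>. Either of these is a third edge inside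
  \<open>e \<union> f\<close>, so the pair is not induced.\<close>

lemma ferrers_rel_edges:
  assumes "bipartite_graph G" "rel_edges R \<subseteq> edges G"
    and cross: "\<And>i j k l. (i, j) \<in> R \<Longrightarrow> (k, l) \<in> R \<Longrightarrow> i \<noteq> k \<Longrightarrow> j \<noteq> l \<Longrightarrow> (i, l) \<in> R \<or> (k, j) \<in> R"
  shows "ferrers (G\<lparr>edges := rel_edges R\<rparr>)"
proof -
  have "\<not> has_induced_2K2 (G\<lparr>edges := rel_edges R\<rparr>)"
  proof
    assume "has_induced_2K2 (G\<lparr>edges := rel_edges R\<rparr>)"
    then obtain e f where e: "e \<in> rel_edges R" and f: "f \<in> rel_edges R" and "e \<inter> f = {}"
      and induced: "\<And>g. g \<in> rel_edges R \<Longrightarrow> g \<subseteq> e \<union> f \<Longrightarrow> g = e \<or> g = f"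
      by (auto simp: has_induced_2K2_def)
    from e obtain i j where ij: "e = {Inl i, Inr j}" "(i, j) \<in> R" by (rule rel_edgesE)
    from f obtain k l where kl: "f = {Inl k, Inr l}" "(k, l) \<in> R" by (rule rel_edgesE)
    have "i \<noteq> k" "j \<noteq> l"
      using \<open>e \<inter> f = {}\<close> ij kl by auto
    with cross[OF ij(2) kl(2)] consider "(i, l) \<in> R" | "(k, j) \<in> R" by blast
    then show False
      using induced[of "{Inl i, Inr l}"] induced[of "{Inl k, Inr j}"] ij kl \<open>i \<noteq> k\<close> \<open>j \<noteq> l\<close>
      by cases (auto simp: doubleton_eq_iff)
  qed
  moreover have "bipartite_graph (G\<lparr>edges := rel_edges R\<rparr>)"
    using assms(1,2) by (auto simp: bipartite_graph_def)
  ultimately show ?thesis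
    by (simp add: ferrers_def)
qed

lemma not_ferrers_crown:
  assumes "n \<ge> 2"
  shows "\<not> ferrers (crown n)"
proof -
  let ?e = "{Inl 1, Inr 2} :: (nat + nat) set" and ?f = "{Inl 2, Inr 1} :: (nat + nat) set"
  have "?e \<in> edges (crown n)" "?f \<in> edges (crown n)"
    using assms by (simp_all add: edges_crown)
  \<comment> \<open>The four endpoints leave only the pairs (1, 1) and (2, 2) as further candidates,
    and the crown omits the diagonal.\<close>
  moreover have "g = ?e \<or> g = ?f" if "g \<in> edges (crown n)" "g \<subseteq> ?e \<union> ?f" for g
    using that by (auto simp: edges_crown elim!: rel_edgesE)
  ultimately have "has_induced_2K2 (crown n)"
    unfolding has_induced_2K2_def by (intro bexI[of _ ?e] bexI[of _ ?f]) auto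
  then show ?thesis
    by (simp add: ferrers_def)
qed

lemma fp_crown:
  assumes "n \<ge> 2"
  shows "fp (crown n) = 2"
  unfolding fp_def
proof (rule Least_equality)
  define L where "L = {(i, j) \<in> {1..n} \<times> {1..n}. i < j}"
  define M where "M = {(i, j) \<in> {1..n} \<times> {1..n}. j < i}"
  have LM: "edges (crown n) = rel_edges L \<union> rel_edges M"
    unfolding edges_crown rel_edges_Un[symmetric] L_def M_def by (rule arg_cong[of _ _ rel_edges]) auto
  have disj: "rel_edges L \<inter> rel_edges M = {}"
    by (rule rel_edges_disjoint) (auto simp: L_def M_def)
  have "{Inl 1, Inr 2} \<in> rel_edges L" "{Inl 2, Inr 1} \<in> rel_edges M"
    using assms by (simp_all add: L_def M_def)
  then have ne: "rel_edges L \<noteq> {}" "rel_edges M \<noteq> {}" by blast+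
  \<comment> \<open>Distinctness makes the two-block partition have \<open>card\<close> 2 rather
    than 1.\<close>
  with disj have "rel_edges L \<noteq> rel_edges M" by blast
  moreover have "partition_on (edges (crown n)) {rel_edges L, rel_edges M}"
    using LM disj ne by (auto simp: partition_on_def disjoint_def)
  moreover have "ferrers (crown n\<lparr>edges := rel_edges L\<rparr>)"
    by (rule ferrers_rel_edges[OF bipartite_graph_crown]) (use LM in \<open>auto simp: L_def\<close>)
  \<comment> \<open>Here the larger left index supplies the cross edge: if \<open>i < k\<close>,
    then \<open>j < i < k\<close> gives \<open>(k, j) \<in> M\<close>.\<close>
  moreover have "ferrers (crown n\<lparr>edges := rel_edges M\<rparr>)"
    by (rule ferrers_rel_edges[OF bipartite_graph_crown]) (use LM in \<open>auto simp: M_def\<close>)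
  ultimately show "\<exists>P. partition_on (edges (crown n)) P \<and> finite P \<and> card P = 2 \<and>
      (\<forall>F\<in>P. ferrers (crown n\<lparr>edges := F\<rparr>))"
    by (intro exI[of _ "{rel_edges L, rel_edges M}"]) simp
next
  fix k
  assume "\<exists>P. partition_on (edges (crown n)) P \<and> finite P \<and> card P = k \<and>
      (\<forall>F\<in>P. ferrers (crown n\<lparr>edges := F\<rparr>))"
  then obtain P where P: "partition_on (edges (crown n)) P" "finite P" "card P = k"
    "\<forall>F\<in>P. ferrers (crown n\<lparr>edges := F\<rparr>)" by blast
  have "{Inl 1, Inr 2} \<in> edges (crown n)"
    using assms by (simp add: edges_crown)
  then have "P \<noteq> {}"
    using partition_onD1[OF P(1)] by auto
  then have "k \<noteq> 0"
    using P(2,3) by auto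
  moreover have "k \<noteq> 1"
  proof
    assume "k = 1"
    then obtain F where "P = {F}"
      using P(3) by (auto simp: card_1_singleton_iff)
    then have "F = edges (crown n)"
      using partition_onD1[OF P(1)] by simp
    \<comment> \<open>The record update with the full edge set gives back the crown.\<close>
    then have "ferrers (crown n)"
      using P(4) \<open>P = {F}\<close> by simp
    with not_ferrers_crown[OF assms] show False ..
  qed
  ultimately show "2 \<le> k" by linarith
qed

text \<open>The family itself is an admissible choice of \<open>\<A>\<close>, and by finiteness no
  subfamily has larger cardinality.\<close>

lemma family_width_antichain:
  assumes "finite \<F>" "pairwise (\<lambda>X Y. \<not> X \<subseteq> Y) \<F>"
  shows "family_width \<F> = card \<F>"
  unfolding family_width_def
proof (rule Max_eqI)
  have "{card \<A> | \<A>. \<A> \<subseteq> \<F> \<and> pairwise (\<lambda>X Y. \<not> X \<subseteq> Y) \<A>} \<subseteq> card ` Pow \<F>" by auto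
  then show "finite {card \<A> | \<A>. \<A> \<subseteq> \<F> \<and> pairwise (\<lambda>X Y. \<not> X \<subseteq> Y) \<A>}"
    using assms(1) by (meson finite_Pow_iff finite_imageI finite_subset)
qed (use assms in \<open>auto intro: card_mono\<close>)

text \<open>The assumption on \<open>f\<close> serves twice: it makes distinct images incomparable,
  and it makes \<open>f\<close> injective, so that no two indices share a set.\<close>

lemma family_width_image_antichain:
  assumes "finite A" "\<And>x y. x \<in> A \<Longrightarrow> y \<in> A \<Longrightarrow> f x \<subseteq> f y \<Longrightarrow> x = y"
  shows "family_width (f ` A) = card A"
proof -
  have "pairwise (\<lambda>X Y. \<not> X \<subseteq> Y) (f ` A)"
    using assms(2) by (auto simp: pairwise_def)
  moreover have "inj_on f A"
    using assms(2) by (intro inj_onI) simp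
  ultimately show ?thesis
    using assms(1) by (simp add: family_width_antichain card_image)
qed

lemma nbhd_crown_Inl:
  assumes "i \<in> {1..n}"
  shows "nbhd (crown n) (Inl i) = Inr ` ({1..n} - {i})"
  using assms by (auto simp: nbhd_def crown_def doubleton_eq_iff)

lemma nbhd_crown_Inr:
  assumes "j \<in> {1..n}"
  shows "nbhd (crown n) (Inr j) = Inl ` ({1..n} - {j})"
  using assms by (auto simp: nbhd_def crown_def doubleton_eq_iff)

lemma width_U_crown: "width_U (crown n) = n"
proof -
  have "family_width ((\<lambda>i. nbhd (crown n) (Inl i)) ` {1..n}) = card {1..n}"
    \<comment> \<open>If removing \<open>i\<close> leaves a subset of what removing \<open>j\<close>
      leaves, then \<open>j\<close> itself must have been removed, so \<open>i = j\<close>.\<close>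
    by (rule family_width_image_antichain) (auto simp: nbhd_crown_Inl inj_image_subset_iff)
  then show ?thesis
    by (simp add: width_U_def crown_def image_image)
qed

lemma width_V_crown: "width_V (crown n) = n"
proof -
  have "family_width ((\<lambda>j. nbhd (crown n) (Inr j)) ` {1..n}) = card {1..n}"
    by (rule family_width_image_antichain) (auto simp: nbhd_crown_Inr inj_image_subset_iff)
  then show ?thesis
    by (simp add: width_V_def crown_def image_image)
qed

theorem theorem6p4:
  fixes n :: nat
  assumes "n \<ge> 3"
  shows "fp (crown n) = 2 \<and> width_U (crown n) = n \<and> width_V (crown n) = n"
  using assms by (simp add: fp_crown width_U_crown width_V_crown)

end
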